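(* For all $k\ge 1$, with $S_n^k=\{1,3,5,\dots,2nk-1\}\sqcup\{2k,4k,\dots,2nk\}$ for $n\geq 1$, $$\sum_{n\geq 1}\Lambda_{S_n^k}(x,y,z,\bar{x},\bar{y},\bar{z})\,u^{n-1}= \sum_{n\geq 1}\frac{(y+\bar{x})^{(n-1)}\left((x+\bar{z})^{(n-1)}\right)^{k}u^{n-1}}{\prod_{i=0}^{n-1}\left(1-(x+i)^{k-1}\left[(x+i)(\bar{y}-y) + k(\bar{x}+i)(z-\bar{z}) - (x+i)(\bar{x}+i)\right]u\right)},$$ where $a^{(n)}=a(a+1)\cdots(a+(n-1))$.
   Context: The identity is one of formal power series in $u$ with coefficients in $\mathbb{Z}[x,y,z,\bar x,\bar y,\bar z]$; $a^{(0)}=1$. The set $S_n^k$ consists of all odd integers from $1$ to $2nk-1$ together with the $n$ even integers $2k,4k,\dots,2nk$. Let $S$ be a finite set of positive integers whose largest element $2N$ is even. If $S$ has at least two even elements and $2M$ is its second-largest even element, then $S'=\{s\in S: s\le 2M\}$; if $S$ has only one even element, $S'=\emptyset$. A generalized surjective staircase with domain $S$ is a surjective function $F$ from $S$ onto the set of even elements of $S$ with $F(a)\ge a$ for all $a\in S$. $\mathcal{E}_S$ is the set of all of these. For $F\in\mathcal{E}_S$ define: - An odd $2i-1\in S'$ is a surfixed point of $F$ if $F(2i-1)$ is the least even element of $S$ larger than $2i-1$. It is isolated if there is no $j\in S$, $j\neq 2i-1$, with $F(j)=F(2i-1)$, and doubled otherwise. $\mathrm{si}(F)$ and $\mathrm{sd}(F)$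 are the numbers of isolated and doubled surfixed points. - An even $2i\in S'$ is a fixed point of $F$ if $F(2i)=2i$. It is isolated if there is no $j\in S$, $j\ne 2i$, with $F(j)=2i$, and doubled otherwise. $\mathrm{fi}(F)$ and $\mathrm{fd}(F)$ are the numbers of isolated and doubled fixed points. - An odd (respectively even) element $a\in S'$ is an odd (respectively even) maximum of $F$ if $F(a)=\max S$. $\mathrm{mo}(F)$ and $\mathrm{me}(F)$ are the numbers of odd and even maxima. Elements of $S\setminus S'$ do not count for any statistic. In commuting variables, $$\Lambda_S(x,y,z,\bar x,\bar y,\bar z)=\sum_{F\in\mathcal{E}_S}x^{\mathrm{mo}(F)}y^{\mathrm{fd}(F)}z^{\mathrm{si}(F)}\bar x^{\mathrm{me}(F)}\bar y^{\mathrm{fi}(F)}\bar z^{\mathrm{sd}(F)}.$$ *)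

theory Defs
  imports "HOL-Library.Poly_Mapping" "HOL-Library.FuncSet"
    "HOL-Computational_Algebra.Formal_Power_Series"
begin

datatype indet = X | Y | Z | Xbar | Ybar | Zbar

text \<open>The ring of integer polynomials in six commuting indeterminates: monomials are exponent
  vectors \<^typ>\<open>indet \<Rightarrow>\<^sub>0 nat\<close>, and multiplication is convolution.\<close>

type_synonym int_poly6 = "(indet \<Rightarrow>\<^sub>0 nat) \<Rightarrow>\<^sub>0 int"

definition var :: "indet \<Rightarrow> int_poly6" where
  "var v = Poly_Mapping.single (Poly_Mapping.single v 1) 1"

definition evens :: "nat set \<Rightarrow> nat set" where
  "evens S = {a \<in> S. even a}"

definition truncation :: "nat set \<Rightarrow> nat set" where
  "truncation S =
     (if card (evens S) \<ge> 2 then {s \<in> S. s \<le> Max (evens S - {Max (evens S)})} else {})"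

text \<open>Functions with domain \<^term>\<open>S\<close> are represented as extensional functions, so that
  each of them is counted exactly once.\<close>

definition staircases :: "nat set \<Rightarrow> (nat \<Rightarrow> nat) set" where
  "staircases S = {F \<in> S \<rightarrow>\<^sub>E evens S. F ` S = evens S \<and> (\<forall>a\<in>S. a \<le> F a)}"

definition surfixed :: "nat set \<Rightarrow> (nat \<Rightarrow> nat) \<Rightarrow> nat set" where
  "surfixed S F = {a \<in> truncation S. odd a \<and> F a = Min {e \<in> evens S. a < e}}"

definition fixedpts :: "nat set \<Rightarrow> (nat \<Rightarrow> nat) \<Rightarrow> nat set" where
  "fixedpts S F = {a \<in> truncation S. even a \<and> F a = a}"

text \<open>The competing preimage \<^term>\<open>j\<close> ranges over all of \<^term>\<open>S\<close>, not just over the truncation.\<close>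

definition isolated :: "nat set \<Rightarrow> (nat \<Rightarrow> nat) \<Rightarrow> nat \<Rightarrow> bool" where
  "isolated S F a \<longleftrightarrow> \<not> (\<exists>j\<in>S. j \<noteq> a \<and> F j = F a)"

definition si :: "nat set \<Rightarrow> (nat \<Rightarrow> nat) \<Rightarrow> nat" where
  "si S F = card {a \<in> surfixed S F. isolated S F a}"

definition sd :: "nat set \<Rightarrow> (nat \<Rightarrow> nat) \<Rightarrow> nat" where
  "sd S F = card {a \<in> surfixed S F. \<not> isolated S F a}"

definition fi :: "nat set \<Rightarrow> (nat \<Rightarrow> nat) \<Rightarrow> nat" where
  "fi S F = card {a \<in> fixedpts S F. isolated S F a}"

definition fd :: "nat set \<Rightarrow> (nat \<Rightarrow> nat) \<Rightarrow> nat" where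
  "fd S F = card {a \<in> fixedpts S F. \<not> isolated S F a}"

definition mo :: "nat set \<Rightarrow> (nat \<Rightarrow> nat) \<Rightarrow> nat" where
  "mo S F = card {a \<in> truncation S. odd a \<and> F a = Max S}"

definition me :: "nat set \<Rightarrow> (nat \<Rightarrow> nat) \<Rightarrow> nat" where
  "me S F = card {a \<in> truncation S. even a \<and> F a = Max S}"

definition Lambda ::
  "nat set \<Rightarrow> 'a \<Rightarrow> 'a \<Rightarrow> 'a \<Rightarrow> 'a \<Rightarrow> 'a \<Rightarrow> 'a \<Rightarrow> 'a::comm_ring_1" where
  "Lambda S x y z xb yb zb =
     (\<Sum>F\<in>staircases S.
        x ^ mo S F * y ^ fd S F * z ^ si S F * xb ^ me S F * yb ^ fi S F * zb ^ sd S F)"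

definition Snk :: "nat \<Rightarrow> nat \<Rightarrow> nat set" where
  "Snk n k = {a. odd a \<and> a \<le> 2 * n * k - 1} \<union> {2 * k * i | i. i \<in> {1..n}}"

text \<open>The coefficient ring is not a field, so the \<^class>\<open>inverse\<close> operations of power series do not
  apply. For \<^term>\<open>f\<close> with constant coefficient 1, the series below is the unique
  \<^term>\<open>g\<close> with \<^prop>\<open>f * g = 1\<close>.\<close>

definition fps_recip :: "'a::comm_ring_1 fps \<Rightarrow> 'a fps" where
  "fps_recip f = fps_right_inverse f 1"

end

theory Submission
  imports Defs
begin

text \<open>
  Let S have an even maximum and at least two even elements, let T be its truncation, and let mid
  and peak be the largest elements of T and S. A staircase on S arises from a unique staircase F on T: among the elements that F sends to mid, a proper subset D is
  raised to peak, and everything in S outside T has no choice but peak. The subset has to be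
  proper because mid must still be hit. An element of the truncation of T that F sends to mid is a
  maximum of F; after the lift it is a maximum if it is raised and carries no weight if it is not.
  An element of T outside the truncation of T always goes to mid under F; when it is not raised it
  becomes a surfixed or fixed point, and it is isolated exactly when it is the only element of the
  fiber that is not raised. No other statistic changes.

  If all unraised elements of the fiber counted as doubled, summing over all subsets D would
  turn every maximum weight x or xb into x + 1 or xb + 1, every new odd element into
  x + zb, and mid into y + xb. Removing the term where everything is raised, and correcting the
  terms where exactly one new element is not raised, gives (lemma \<open>Lambda_step\<close>), with r the number
  of odd elements of T outside the truncation of T,
  \<open>\<Lambda>\<^sub>S(x, xb) = (x + zb)^r (y + xb) \<Lambda>\<^sub>T(x + 1, xb + 1)
    + (x^r (yb - y - xb) + r x^(r - 1) xb (z - zb)) \<Lambda>\<^sub>T(x, xb)\<close>.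

  For the sets in the theorem r = k, and the coefficient of the unshifted term, taken at
  (x + i, xb + i), is the coefficient a i of -u in the i-th factor of the denominators. With b i the
  coefficient of the shifted term and G i the generating function at that point, the recurrence says
  \<open>G i (1 - a i u) = 1 + b i u G (i + 1)\<close>, and iterating this from i = 0 produces the series on the
  right-hand side, with a remainder divisible by arbitrarily high powers of u
  (lemma \<open>fps_sums_of_linear_recurrence\<close>).
\<close>

section \<open>Sums over proper subsets\<close>

lemma power_card_eq_prod:
  assumes "finite P"
  shows "(c :: 'a :: comm_monoid_mult) ^ card {a \<in> P. Q a} = (\<Prod>a\<in>P. if Q a then c else 1)"
  using assms by (simp add: prod.inter_filter[symmetric])

text \<open>
  This evaluates the choice of the raised set D inside a fiber P: f is the weight of a
  raised element, g that of an unraised one, and h replaces g when the unraised element is the only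
  one. Expanding the product of the f a + g a gives the sum over all subsets with g throughout; the set
  P itself is subtracted, and only the sets D = P - {a} see the difference between h and g.
\<close>

lemma sum_proper_subsets_prod:
  fixes f g h :: "'b \<Rightarrow> 'a :: comm_ring_1"
  assumes P: "finite P"
  shows "(\<Sum>D | D \<subset> P. \<Prod>a\<in>P. if a \<in> D then f a else if P - D = {a} then h a else g a) =
    (\<Prod>a\<in>P. f a + g a) - prod f P + (\<Sum>a\<in>P. (h a - g a) * prod f (P - {a}))"
proof -
  define w where "w D = (\<Prod>a\<in>P. if a \<in> D then f a else if P - D = {a} then h a else g a)" for D
  define v where "v D = (\<Prod>a\<in>P. if a \<in> D then f a else g a)" for D
  have v_split: "v D = prod f D * prod g (P - D)" if "D \<subseteq> P" for D
    using that P unfolding v_def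
    by (simp add: prod.If_cases Int_absorb1 Diff_eq)
  have vP: "v P = prod f P" by (simp add: v_def)
  have w_single: "w (P - {a}) = v (P - {a}) + (h a - g a) * prod f (P - {a})" if a: "a \<in> P" for a
  proof -
    have "w (P - {a}) = h a * (\<Prod>b\<in>P - {a}. f b)"
      unfolding w_def using a P by (subst prod.remove[OF P a]) (auto intro!: arg_cong2[of _ _ _ _ "(*)"] prod.cong)
    moreover have "v (P - {a}) = g a * (\<Prod>b\<in>P - {a}. f b)"
      unfolding v_def using a P by (subst prod.remove[OF P a]) (auto intro!: arg_cong2[of _ _ _ _ "(*)"] prod.cong)
    ultimately show ?thesis by (simp add: algebra_simps)
  qed
  have w_other: "w D = v D" if "D \<subset> P" "D \<notin> (\<lambda>a. P - {a}) ` P" for D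
  proof -
    have neq: "P - D \<noteq> {a}" for a
      using that by (metis Diff_Diff_Int Diff_iff imageI inf.absorb_iff2 insertI1 psubset_imp_subset)
    show ?thesis unfolding w_def v_def by (simp only: neq if_False)
  qed
  let ?C = "(\<lambda>a. P - {a}) ` P"
  have inj: "inj_on (\<lambda>a. P - {a}) P" by (auto simp: inj_on_def)
  have C: "?C \<subseteq> {D. D \<subset> P}" by auto
  have fin: "finite {D. D \<subset> P}" using P by (rule finite_subset[rotated, OF finite_Pow_iff[THEN iffD2]]) auto
  have "(\<Sum>D | D \<subset> P. w D) = (\<Sum>D | D \<subset> P. v D + (w D - v D))" by simp
  also have "\<dots> = (\<Sum>D | D \<subset> P. v D) + (\<Sum>D | D \<subset> P. w D - v D)" by (rule sum.distrib)
  also have "(\<Sum>D | D \<subset> P. w D - v D) = (\<Sum>D\<in>?C. w D - v D)"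
    using fin C w_other by (intro sum.mono_neutral_right) auto
  also have "\<dots> = (\<Sum>a\<in>P. (h a - g a) * prod f (P - {a}))"
    by (simp add: sum.reindex[OF inj] w_single)
  also have "(\<Sum>D | D \<subset> P. v D) = (\<Sum>D\<in>Pow P. v D) - v P"
  proof -
    have "Pow P = insert P {D. D \<subset> P}" by auto
    then show ?thesis using fin by simp
  qed
  also have "(\<Sum>D\<in>Pow P. v D) = (\<Prod>a\<in>P. f a + g a)"
    using P by (simp add: prod_add v_split)
  finally show ?thesis by (simp add: vP w_def)
qed

section \<open>Power series given by a linear recurrence\<close>

lemma fps_recip_mult:
  fixes f :: "'a :: comm_ring_1 fps"
  assumes "fps_nth f 0 = 1"
  shows "f * fps_recip f = 1"
  unfolding fps_recip_def using assms by (intro fps_right_inverse) simp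

lemma fps_recip_factor:
  fixes f g :: "'a :: comm_ring_1 fps"
  assumes "fps_nth f 0 = 1" "fps_nth g 0 = 1"
  shows "fps_recip f = fps_recip (f * g) * g"
proof -
  have fg: "(f * g) * fps_recip (f * g) = 1" using assms by (intro fps_recip_mult) simp
  have f: "f * fps_recip f = 1" using assms by (intro fps_recip_mult)
  have "fps_recip f = fps_recip f * ((f * g) * fps_recip (f * g))" by (simp add: fg)
  also have "\<dots> = (f * fps_recip f) * (fps_recip (f * g) * g)" by (simp only: mult_ac)
  finally show ?thesis by (simp add: f)
qed

text \<open>
  Unfolding the recurrence n times expresses G 0 as the n-th partial sum plus a remainder that
  contains the factor X^n, so each coefficient of the partial sums is eventually that of G 0.
\<close>

lemma fps_sums_of_linear_recurrence:
  fixes a b :: "nat \<Rightarrow> 'a :: comm_ring_1" and G :: "nat \<Rightarrow> 'a fps"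
  assumes rec: "\<And>i. G i * (1 - fps_const (a i) * fps_X) = 1 + fps_const (b i) * fps_X * G (Suc i)"
  shows "(\<lambda>m. fps_const (\<Prod>i<m. b i) * fps_X ^ m *
      fps_recip (\<Prod>i = 0..m. 1 - fps_const (a i) * fps_X)) sums G 0"
proof -
  define q where "q i = 1 - fps_const (a i) * fps_X" for i
  define R where "R n = fps_recip (\<Prod>i<n. q i)" for n
  define t where "t m = fps_const (\<Prod>i<m. b i) * fps_X ^ m * R (Suc m)" for m
  have q0: "fps_nth (\<Prod>i<n. q i) 0 = 1" for n
    by (induction n) (simp_all add: q_def)
  have R_Suc: "R n = R (Suc n) * q n" for n
    using fps_recip_factor[OF q0[of n], of "q n"] by (simp add: R_def q_def)
  have R0: "R 0 = 1"
    using fps_recip_mult[of 1] by (simp add: R_def)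
  have rest: "G 0 = (\<Sum>m<n. t m) + fps_const (\<Prod>i<n. b i) * fps_X ^ n * (R n * G n)" for n
  proof (induction n)
    case 0
    show ?case by (simp add: R0)
  next
    case (Suc n)
    have "R n * G n = R (Suc n) * (G n * q n)"
      by (simp add: R_Suc[of n] mult_ac)
    also have "\<dots> = R (Suc n) + fps_const (b n) * fps_X * (R (Suc n) * G (Suc n))"
      unfolding q_def rec by (simp add: algebra_simps)
    finally show ?case
      unfolding Suc t_def sum.lessThan_Suc prod.lessThan_Suc fps_const_mult[symmetric]
      by (simp only: algebra_simps power_Suc)
  qed
  have "(\<lambda>n. \<Sum>m<n. t m) \<longlonglongrightarrow> G 0"
  proof (rule tendsto_fpsI)
    fix j
    show "\<forall>\<^sub>F n in sequentially. fps_nth (\<Sum>m<n. t m) j = fps_nth (G 0) j"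
      using eventually_gt_at_top[of j]
    proof eventually_elim
      case (elim n)
      have "fps_nth (fps_const (\<Prod>i<n. b i) * fps_X ^ n * (R n * G n)) j = 0"
        using elim by (simp add: mult.assoc fps_X_power_mult_nth)
      then show ?case
        by (metis rest fps_add_nth add.right_neutral)
    qed
  qed
  then show ?thesis
    by (simp add: sums_def t_def R_def q_def lessThan_Suc_atMost atMost_atLeast0)
qed

section \<open>Staircases on a set and on its truncation\<close>

text \<open>
  This description covers both cases in the definition of the truncation: when the
  maximum is the only even element, no e exists and the truncation is empty.
\<close>

lemma mem_truncation_iff:
  assumes fin: "finite S" and ne: "S \<noteq> {}" and ev: "even (Max S)"
  shows "a \<in> truncation S \<longleftrightarrow> a \<in> S \<and> (\<exists>e\<in>evens S. a \<le> e \<and> e < Max S)"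
proof -
  let ?E = "evens S - {Max S}"
  have top: "Max S \<in> evens S" using assms by (simp add: evens_def)
  have finE: "finite (evens S)" using fin by (simp add: evens_def)
  have MaxE: "Max (evens S) = Max S"
    using top fin by (intro Max_eqI finE) (auto simp: evens_def)
  have less: "e < Max S \<longleftrightarrow> e \<noteq> Max S" if "e \<in> evens S" for e
    using that fin Max_ge[of S e] by (auto simp: evens_def order.strict_iff_order)
  show ?thesis
  proof (cases "?E = {}")
    case True
    then have "evens S = {Max S}" using top by auto
    then show ?thesis by (simp add: truncation_def)
  next
    case False
    have "card ?E \<noteq> 0" using False finE by simp
    then have "2 \<le> card (evens S)" using top finE by (simp add: card_Diff_singleton)
    then show ?thesis
      using False finE less by (auto simp: truncation_def MaxE Max_ge_iff)
  qed
qed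

locale staircase_step =
  fixes S :: "nat set"
  assumes fin: "finite S" and top_even: "even (Max S)" and two: "2 \<le> card (evens S)"
begin

abbreviation "T \<equiv> truncation S"
abbreviation "peak \<equiv> Max S"
abbreviation "mid \<equiv> Max T"

lemma finE: "finite (evens S)" using fin by (simp add: evens_def)

lemma S_ne: "S \<noteq> {}" using two by (auto simp: evens_def)

lemma mem_T: "a \<in> T \<longleftrightarrow> a \<in> S \<and> (\<exists>e\<in>evens S. a \<le> e \<and> e < peak)"
  using fin S_ne top_even by (rule mem_truncation_iff)

lemma T_sub: "T \<subseteq> S" and finT: "finite T"
  using mem_T fin by (auto intro: finite_subset)

lemma peak: "peak \<in> S" "peak \<in> evens S" "peak \<notin> T"
proof -
  show "peak \<in> S" using fin S_ne by (rule Max_in)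
  then show "peak \<in> evens S" using top_even by (simp add: evens_def)
  show "peak \<notin> T"
    using fin Max_ge[OF fin] by (force simp: mem_T evens_def)
qed

lemma T_ne: "T \<noteq> {}"
proof -
  have "\<not> evens S \<subseteq> {peak}"
    using two card_mono[of "{peak}" "evens S"] by auto
  then obtain e where e: "e \<in> evens S" "e \<noteq> peak" by auto
  then have "e < peak" using fin Max_ge[of S e] by (auto simp: evens_def order.strict_iff_order)
  then show ?thesis using e mem_T by (auto simp: evens_def)
qed

lemma mid: "mid \<in> T" "even mid" "mid < peak" "mid \<in> evens T" "mid \<in> S"
proof -
  show m: "mid \<in> T" using finT T_ne by simp
  then obtain e where e: "e \<in> evens S" "mid \<le> e" "e < peak" by (auto simp: mem_T)
  then have "e \<in> T" by (auto simp: mem_T evens_def)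
  then have "e = mid" using e(2) finT by (simp add: antisym)
  then show "even mid" "mid < peak" using e by (auto simp: evens_def)
  with m show "mid \<in> evens T" "mid \<in> S" using T_sub by (auto simp: evens_def)
qed

lemma T_le: "a \<in> T \<Longrightarrow> a \<le> mid" using finT by simp

lemma evens_S: "evens S = insert peak (evens T)"
proof -
  have "e \<in> T" if "e \<in> evens S" "e \<noteq> peak" for e
    using that fin Max_ge[of S e] by (auto simp: evens_def mem_T order.strict_iff_order)
  then show ?thesis using T_sub peak by (auto simp: evens_def)
qed

lemma evens_T_le: "e \<in> evens T \<Longrightarrow> e \<le> mid" using T_le by (simp add: evens_def)

lemma not_in_T: "a \<in> S - T \<Longrightarrow> e \<in> evens S \<Longrightarrow> a \<le> e \<Longrightarrow> e = peak"
  using fin Max_ge[of S e] by (auto simp: evens_def mem_T order.strict_iff_order)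

lemma mem_T2: "a \<in> truncation T \<longleftrightarrow> a \<in> T \<and> (\<exists>e\<in>evens T. a \<le> e \<and> e < mid)"
  using finT T_ne mid(2) by (rule mem_truncation_iff)

lemma even_T2: "a \<in> T \<Longrightarrow> even a \<Longrightarrow> a \<in> truncation T \<longleftrightarrow> a \<noteq> mid"
  using T_le[of a] by (auto simp: mem_T2 evens_def order.strict_iff_order dest: T_le)

text \<open>
  A surfixed point is defined by its next larger even element. For elements of T this does not depend
  on whether S or T is meant, and it equals mid exactly on the part of T that the truncation of T
  drops. Hence surfixed points with value mid appear only there.
\<close>

lemma Min_next_even:
  assumes "a \<in> T" "odd a"
  shows "Min {e \<in> evens S. a < e} = Min {e \<in> evens T. a < e}"
    and "Min {e \<in> evens T. a < e} \<le> mid"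
    and "Min {e \<in> evens T. a < e} = mid \<longleftrightarrow> a \<notin> truncation T"
proof -
  let ?N = "{e \<in> evens T. a < e}"
  have lt: "a < mid" using assms T_le mid by (metis order.strict_iff_order)
  then have ne: "?N \<noteq> {}" and finN: "finite ?N" using mid finE evens_S by auto
  have S: "{e \<in> evens S. a < e} = insert peak ?N"
    using evens_S lt mid by auto
  show le: "Min ?N \<le> mid" using lt mid finN by (intro Min_le) auto
  then show "Min {e \<in> evens S. a < e} = Min ?N"
    using mid(3) unfolding S Min_insert[OF finN ne] by (simp add: min_def)
  have "Min ?N < mid \<longleftrightarrow> a \<in> truncation T"
    unfolding Min_less_iff[OF finN ne] using assms
    by (auto simp: mem_T2 evens_def order.strict_iff_order)
  then show "Min ?N = mid \<longleftrightarrow> a \<notin> truncation T" using le by linarith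
qed

definition fiber :: "(nat \<Rightarrow> nat) \<Rightarrow> nat set" where
  "fiber F = {a \<in> T. F a = mid}"

text \<open>
  The set D is raised to peak, and so is S - T, where peak is the only possible value.
\<close>

definition lift :: "(nat \<Rightarrow> nat) \<Rightarrow> nat set \<Rightarrow> nat \<Rightarrow> nat" where
  "lift F D = restrict (\<lambda>a. if a \<in> T - D then F a else peak) S"

lemma fiber_sub: "fiber F \<subseteq> T" and fin_fiber: "finite (fiber F)"
  using finT by (auto simp: fiber_def)

lemma staircaseT:
  assumes "F \<in> staircases T" "a \<in> T"
  shows "F a \<in> evens T" "a \<le> F a" "F a \<le> mid" "F a \<noteq> peak"
proof -
  show 1: "F a \<in> evens T" "a \<le> F a" using assms by (auto simp: staircases_def)
  then show "F a \<le> mid" by (intro evens_T_le)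
  then show "F a \<noteq> peak" using mid by linarith
qed

text \<open>
  Beyond the truncation of T, the only even element of T that is large enough is mid.
\<close>

lemma staircaseT_block:
  assumes "F \<in> staircases T" "a \<in> T" "a \<notin> truncation T"
  shows "a \<in> fiber F"
  using assms staircaseT[of F a] by (auto simp: fiber_def mem_T2 order.strict_iff_order)

lemma lift_staircase:
  assumes F: "F \<in> staircases T" and D: "D \<subset> fiber F"
  shows "lift F D \<in> staircases S"
proof -
  have "lift F D \<in> S \<rightarrow>\<^sub>E evens S"
    using staircaseT[OF F] evens_S by (auto simp: lift_def)
  moreover have "\<forall>a\<in>S. a \<le> lift F D a"
    using staircaseT[OF F] fin by (auto simp: lift_def)
  moreover have "e \<in> lift F D ` S" if e: "e \<in> evens S" for e
  proof -
    consider "e = peak" | "e = mid" | "e \<in> evens T" "e \<noteq> mid" using e evens_S by auto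
    then show ?thesis
    proof cases
      case 1
      then have "lift F D peak = e" using peak by (simp add: lift_def)
      then show ?thesis using peak by blast
    next
      case 2
      from D obtain a where "a \<in> fiber F" "a \<notin> D" by auto
      then have "lift F D a = e" "a \<in> S" using 2 T_sub by (auto simp: fiber_def lift_def)
      then show ?thesis by blast
    next
      case 3
      have "e \<in> F ` T" using F 3(1) by (simp add: staircases_def)
      then obtain a where "a \<in> T" "F a = e" by auto
      then have "lift F D a = e" "a \<in> S" using 3 T_sub D by (auto simp: fiber_def lift_def)
      then show ?thesis by blast
    qed
  qed
  ultimately show ?thesis by (auto simp: staircases_def)
qed

text \<open>
  The inverse of lifting: values peak come down to mid, and the raised set is remembered.
\<close>

definition lower :: "(nat \<Rightarrow> nat) \<Rightarrow> nat \<Rightarrow> nat" where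
  "lower F = restrict (\<lambda>a. min (F a) mid) T"

definition lifted :: "(nat \<Rightarrow> nat) \<Rightarrow> nat set" where
  "lifted F = {a \<in> T. F a = peak}"

lemma staircaseS:
  assumes "F \<in> staircases S" "a \<in> S"
  shows "F a \<in> evens S" "a \<le> F a" "F a \<noteq> peak \<Longrightarrow> F a \<in> evens T \<and> F a \<le> mid"
    "a \<notin> T \<Longrightarrow> F a = peak"
proof -
  show 1: "F a \<in> evens S" "a \<le> F a" using assms by (auto simp: staircases_def)
  then show "F a \<noteq> peak \<Longrightarrow> F a \<in> evens T \<and> F a \<le> mid" using evens_S evens_T_le by auto
  show "a \<notin> T \<Longrightarrow> F a = peak" using 1 assms not_in_T by blast
qed

lemma lower_eq:
  assumes "F \<in> staircases S" "a \<in> T"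
  shows "lower F a = (if F a = peak then mid else F a)"
proof -
  have "a \<in> S" using assms T_sub by auto
  then show ?thesis using staircaseS(3)[OF assms(1), of a] assms mid by (auto simp: lower_def)
qed

lemma lower_staircase:
  assumes F: "F \<in> staircases S"
  shows "lower F \<in> staircases T" "lifted F \<subset> fiber (lower F)"
proof -
  have onto: "\<exists>a\<in>T. F a = e" if "e \<in> evens T" for e
  proof -
    have "e \<in> F ` S" using F that evens_S by (auto simp: staircases_def)
    then obtain a where a: "a \<in> S" "F a = e" by auto
    moreover have "e \<noteq> peak" using that peak by (auto simp: evens_def)
    ultimately show ?thesis using staircaseS(4)[OF F] by blast
  qed
  have val: "lower F a \<in> evens T" "a \<le> lower F a" if "a \<in> T" for a
  proof -
    have "a \<in> S" using that T_sub by auto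
    then show "lower F a \<in> evens T" "a \<le> lower F a"
      using staircaseS[OF F, of a] lower_eq[OF F that] mid T_le[OF that] by auto
  qed
  have "e \<in> lower F ` T" if e: "e \<in> evens T" for e
  proof -
    obtain a where a: "a \<in> T" "F a = e" using onto e by auto
    moreover have "e \<noteq> peak" using e peak by (auto simp: evens_def)
    ultimately show ?thesis using lower_eq[OF F, of a] by (intro image_eqI[of _ _ a]) auto
  qed
  then show "lower F \<in> staircases T"
    using val by (auto simp: staircases_def lower_def)
  obtain a where "a \<in> T" "F a = mid" using onto mid by auto
  then have "a \<in> fiber (lower F) - lifted F"
    using mid lower_eq[OF F, of a] by (auto simp: fiber_def lifted_def)
  moreover have "lifted F \<subseteq> fiber (lower F)"
    using lower_eq[OF F] by (auto simp: fiber_def lifted_def)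
  ultimately show "lifted F \<subset> fiber (lower F)" by auto
qed

lemma lift_lower:
  assumes F: "F \<in> staircases S"
  shows "lift (lower F) (lifted F) = F"
proof
  fix a
  show "lift (lower F) (lifted F) a = F a"
  proof (cases "a \<in> S")
    case True
    then show ?thesis using staircaseS(4)[OF F True] lower_eq[OF F, of a]
      by (auto simp: lift_def lifted_def)
  next
    case False
    then show ?thesis using F by (auto simp: lift_def staircases_def PiE_def extensional_def)
  qed
qed

lemma lift_at:
  assumes "D \<subseteq> fiber F" "a \<in> T"
  shows "lift F D a = (if a \<in> D then peak else F a)"
  using assms T_sub by (auto simp: lift_def)

lemma lower_lift:
  assumes F: "F \<in> staircases T" and D: "D \<subset> fiber F"
  shows "lower (lift F D) = F" "lifted (lift F D) = D"
proof -
  have at: "lift F D a = (if a \<in> D then peak else F a)" if "a \<in> T" for a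
    using that lift_at D by auto
  show "lifted (lift F D) = D"
    using D fiber_sub[of F] staircaseT(4)[OF F] by (auto simp: lifted_def at split: if_splits)
  show "lower (lift F D) = F"
  proof
    fix a
    show "lower (lift F D) a = F a"
    proof (cases "a \<in> T")
      case True
      then show ?thesis
        using staircaseT[OF F True] D mid by (auto simp: lower_def at fiber_def min_def)
    next
      case False
      then show ?thesis using F by (auto simp: lower_def staircases_def PiE_def extensional_def)
    qed
  qed
qed

text \<open>
  The maps (F, D) to lift F D and G to (lower G, lifted G) are mutually inverse bijections between
  the staircases on S and the pairs of a staircase F on T and a proper subset D of its fiber.
\<close>

lemma sum_staircases_step:
  "(\<Sum>F\<in>staircases S. w F) = (\<Sum>F\<in>staircases T. \<Sum>D | D \<subset> fiber F. w (lift F D))"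
proof -
  have fins: "finite (staircases T)"
  proof -
    have "finite (T \<rightarrow>\<^sub>E evens T)" using finT by (intro finite_PiE) (auto simp: evens_def)
    then show ?thesis by (rule finite_subset[rotated]) (auto simp: staircases_def)
  qed
  have finD: "finite {D. D \<subset> fiber F}" for F
    by (rule finite_subset[of _ "Pow (fiber F)"]) (auto simp: fin_fiber)
  have "(\<Sum>F\<in>staircases S. w F) =
      (\<Sum>(F, D)\<in>Sigma (staircases T) (\<lambda>F. {D. D \<subset> fiber F}). w (lift F D))"
  proof (rule sum.reindex_bij_witness
      [where i = "\<lambda>(F, D). lift F D" and j = "\<lambda>F. (lower F, lifted F)"], goal_cases)
    case (1 F)
    then show ?case by (simp add: lift_lower)
  next
    case (2 F)
    then show ?case by (simp add: lower_staircase)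
  next
    case (3 p)
    then show ?case by (cases p) (simp add: lower_lift)
  next
    case (4 p)
    then show ?case by (cases p) (simp add: lift_staircase)
  next
    case (5 F)
    then show ?case by (simp add: lift_lower)
  qed
  also have "\<dots> = (\<Sum>F\<in>staircases T. \<Sum>D | D \<subset> fiber F. w (lift F D))"
    using fins finD by (simp add: sum.Sigma)
  finally show ?thesis .
qed

section \<open>The weight of a lifted staircase\<close>

abbreviation "block \<equiv> T - truncation T"

lemma isolated_lift_outside:
  assumes F: "F \<in> staircases T" and D: "D \<subset> fiber F" and a: "a \<in> T" "F a \<noteq> mid"
  shows "isolated S (lift F D) a \<longleftrightarrow> isolated T F a"
proof -
  have DT: "D \<subseteq> fiber F" using D by auto
  have la: "lift F D a = F a" using a DT by (auto simp: lift_at[OF DT] fiber_def)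
  have "(j \<in> S \<and> lift F D j = F a) \<longleftrightarrow> (j \<in> T \<and> F j = F a)" for j
    using a T_sub DT staircaseT(4)[OF F a(1)] by (auto simp: lift_def fiber_def)
  then show ?thesis unfolding isolated_def la by blast
qed

text \<open>
  Elements of S outside T go to peak, so only unraised elements of the fiber compete for mid.
\<close>

lemma isolated_lift_fiber:
  assumes F: "F \<in> staircases T" and D: "D \<subset> fiber F" and a: "a \<in> fiber F - D"
  shows "isolated S (lift F D) a \<longleftrightarrow> fiber F - D = {a}"
proof -
  have DT: "D \<subseteq> fiber F" using D by auto
  have aT: "a \<in> T" "F a = mid" using a by (auto simp: fiber_def)
  have la: "lift F D a = mid" using a aT by (auto simp: lift_at[OF DT])
  have "(j \<in> S \<and> lift F D j = mid) \<longleftrightarrow> j \<in> fiber F - D" for j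
    using mid(3) T_sub DT by (auto simp: lift_def fiber_def)
  then show ?thesis unfolding isolated_def la using a by blast
qed

text \<open>
  Inside the truncation of T the next even element is below mid, so raising elements from mid to
  peak does not affect surfixed points there. In the block it is mid, and the unraised elements
  become surfixed.
\<close>

lemma surfixed_lift:
  assumes F: "F \<in> staircases T" and D: "D \<subset> fiber F"
  shows "surfixed S (lift F D) = surfixed T F \<union> {a \<in> fiber F. a \<in> block \<and> odd a \<and> a \<notin> D}"
proof -
  have DT: "D \<subseteq> fiber F" using D by auto
  have "a \<in> surfixed S (lift F D) \<longleftrightarrow> a \<in> surfixed T F \<or> a \<in> fiber F \<and> a \<in> block \<and> odd a \<and> a \<notin> D"
    if a: "a \<in> T" "odd a" for a
  proof (cases "a \<in> truncation T")
    case True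
    then have "Min {e \<in> evens T. a < e} \<noteq> mid" "Min {e \<in> evens T. a < e} \<noteq> peak"
      using Min_next_even[OF a] mid(3) by auto
    then show ?thesis using True a DT
      by (auto simp: surfixed_def lift_at[OF DT] Min_next_even(1)[OF a] fiber_def)
  next
    case False
    then have "Min {e \<in> evens T. a < e} = mid" "a \<in> fiber F" "F a = mid"
      using Min_next_even[OF a] staircaseT_block[OF F a(1)] by (auto simp: fiber_def)
    then show ?thesis using False a mid(3)
      by (auto simp: surfixed_def lift_at[OF DT] Min_next_even(1)[OF a])
  qed
  moreover have "surfixed S (lift F D) \<union> surfixed T F \<subseteq> {a \<in> T. odd a}"
    using mem_T2 by (auto simp: surfixed_def)
  ultimately show ?thesis by blast
qed

lemma fixedpts_lift:
  assumes F: "F \<in> staircases T" and D: "D \<subset> fiber F"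
  shows "fixedpts S (lift F D) = fixedpts T F \<union> {a \<in> fiber F. a \<in> block \<and> even a \<and> a \<notin> D}"
proof -
  have DT: "D \<subseteq> fiber F" using D by auto
  have "a \<in> fixedpts S (lift F D) \<longleftrightarrow> a \<in> fixedpts T F \<or> a \<in> fiber F \<and> a \<in> block \<and> even a \<and> a \<notin> D"
    if a: "a \<in> T" "even a" for a
  proof (cases "a \<in> truncation T")
    case True
    then have "a \<noteq> mid" "a \<noteq> peak" using a even_T2 peak(3) by auto
    then show ?thesis using True a DT
      by (auto simp: fixedpts_def lift_at[OF DT] fiber_def)
  next
    case False
    then have "a = mid" "a \<in> fiber F" "F a = mid"
      using even_T2[OF a] staircaseT_block[OF F a(1)] by (auto simp: fiber_def)
    then show ?thesis using False a mid(3)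
      by (auto simp: fixedpts_def lift_at[OF DT])
  qed
  moreover have "fixedpts S (lift F D) \<union> fixedpts T F \<subseteq> {a \<in> T. even a}"
    using mem_T2 by (auto simp: fixedpts_def)
  ultimately show ?thesis by blast
qed

lemma surfixed_fixedpts_outside:
  assumes "a \<in> surfixed T F \<union> fixedpts T F"
  shows "a \<in> truncation T" "F a \<noteq> mid"
  using assms Min_next_even(3)[of a] even_T2[of a] mem_T2 by (auto simp: surfixed_def fixedpts_def)

text \<open>
  The part of the summand of F that survives lifting: the maxima of F lose their status,
  everything else is kept.
\<close>

definition weight :: "'a \<Rightarrow> 'a \<Rightarrow> 'a \<Rightarrow> 'a \<Rightarrow> (nat \<Rightarrow> nat) \<Rightarrow> 'a :: comm_ring_1" where
  "weight y z yb zb F = y ^ fd T F * z ^ si T F * yb ^ fi T F * zb ^ sd T F"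

text \<open>
  The new contributions are written as one product over the fiber because the sum over D then
  factorises. Every other contribution is that of F itself.
\<close>

lemma weight_lift:
  fixes x y z xb yb zb :: "'a :: comm_ring_1"
  assumes F: "F \<in> staircases T" and D: "D \<subset> fiber F"
  defines "G \<equiv> lift F D"
  shows "x ^ mo S G * y ^ fd S G * z ^ si S G * xb ^ me S G * yb ^ fi S G * zb ^ sd S G =
    weight y z yb zb F *
      (\<Prod>a\<in>fiber F. if a \<in> D then if odd a then x else xb
        else if fiber F - D = {a} then if a \<in> truncation T then 1 else if odd a then z else yb
        else if a \<in> truncation T then 1 else if odd a then zb else y)"
proof -
  let ?P = "fiber F"
  have DT: "D \<subseteq> ?P" using D by auto
  have fins: "finite (surfixed T F)" "finite (fixedpts T F)"
    using finT by (auto simp: surfixed_def fixedpts_def truncation_def)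
  have outside: "isolated S G a \<longleftrightarrow> isolated T F a" if "a \<in> surfixed T F \<union> fixedpts T F" for a
    unfolding G_def using surfixed_fixedpts_outside[OF that] mem_T2
    by (intro isolated_lift_outside[OF F D]) auto
  have inside: "isolated S G a \<longleftrightarrow> ?P - D = {a}" if "a \<in> ?P" "a \<notin> D" for a
    unfolding G_def using that by (intro isolated_lift_fiber[OF F D]) auto
  \<comment> \<open>Surfixed and fixed points consist of the old ones, A, and new ones in the block. U is the
    property counted on S, V and W are its forms for old and for new points.\<close>
  have split: "c ^ card {a \<in> A \<union> {a \<in> ?P. a \<in> block \<and> R a \<and> a \<notin> D}. U a} =
      c ^ card {a \<in> A. V a} * (\<Prod>a\<in>?P. if a \<in> block \<and> R a \<and> a \<notin> D \<and> W a then c else 1)"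
    if A: "finite A" "A \<subseteq> truncation T" and UV: "\<And>a. a \<in> A \<Longrightarrow> U a \<longleftrightarrow> V a"
      and UW: "\<And>a. a \<in> ?P \<Longrightarrow> a \<notin> D \<Longrightarrow> U a \<longleftrightarrow> W a"
    for c :: 'a and A R U V W
  proof -
    let ?Q = "\<lambda>a. a \<in> block \<and> R a \<and> a \<notin> D \<and> W a"
    have eq: "{a \<in> A \<union> {a \<in> ?P. a \<in> block \<and> R a \<and> a \<notin> D}. U a} = {a \<in> A. V a} \<union> {a \<in> ?P. ?Q a}"
      using UV UW by blast
    have "{a \<in> A. V a} \<inter> {a \<in> ?P. ?Q a} = {}" using A by auto
    then have "card ({a \<in> A. V a} \<union> {a \<in> ?P. ?Q a}) = card {a \<in> A. V a} + card {a \<in> ?P. ?Q a}"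
      using A fin_fiber by (intro card_Un_disjoint) auto
    then show ?thesis
      unfolding eq by (simp only: power_add power_card_eq_prod[OF fin_fiber])
  qed
  have sG: "surfixed S G = surfixed T F \<union> {a \<in> ?P. a \<in> block \<and> odd a \<and> a \<notin> D}"
    and fG: "fixedpts S G = fixedpts T F \<union> {a \<in> ?P. a \<in> block \<and> even a \<and> a \<notin> D}"
    unfolding G_def by (fact surfixed_lift[OF F D] fixedpts_lift[OF F D])+
  have sur: "surfixed T F \<subseteq> truncation T" "fixedpts T F \<subseteq> truncation T"
    by (auto simp: surfixed_def fixedpts_def)
  have pmo: "x ^ mo S G = (\<Prod>a\<in>?P. if a \<in> D \<and> odd a then x else 1)"
    and pme: "xb ^ me S G = (\<Prod>a\<in>?P. if a \<in> D \<and> even a then xb else 1)"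
  proof -
    have "a \<in> T \<and> G a = peak \<longleftrightarrow> a \<in> ?P \<and> a \<in> D" for a
      using lower_lift(2)[OF F D] DT by (auto simp: G_def lifted_def)
    then have "{a \<in> T. odd a \<and> G a = peak} = {a \<in> ?P. a \<in> D \<and> odd a}"
      "{a \<in> T. even a \<and> G a = peak} = {a \<in> ?P. a \<in> D \<and> even a}" by blast+
    then show "x ^ mo S G = (\<Prod>a\<in>?P. if a \<in> D \<and> odd a then x else 1)"
      "xb ^ me S G = (\<Prod>a\<in>?P. if a \<in> D \<and> even a then xb else 1)"
      unfolding mo_def me_def by (simp_all only: power_card_eq_prod[OF fin_fiber])
  qed
  have psi: "z ^ si S G = z ^ si T F *
      (\<Prod>a\<in>?P. if a \<in> block \<and> odd a \<and> a \<notin> D \<and> ?P - D = {a} then z else 1)"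
    unfolding si_def sG
    by (rule split[OF fins(1) sur(1)]) (simp_all only: outside inside Un_iff simp_thms)
  have psd: "zb ^ sd S G = zb ^ sd T F *
      (\<Prod>a\<in>?P. if a \<in> block \<and> odd a \<and> a \<notin> D \<and> ?P - D \<noteq> {a} then zb else 1)"
    unfolding sd_def sG
    by (rule split[OF fins(1) sur(1)]) (simp_all only: outside inside Un_iff simp_thms)
  have pfi: "yb ^ fi S G = yb ^ fi T F *
      (\<Prod>a\<in>?P. if a \<in> block \<and> even a \<and> a \<notin> D \<and> ?P - D = {a} then yb else 1)"
    unfolding fi_def fG
    by (rule split[OF fins(2) sur(2)]) (simp_all only: outside inside Un_iff simp_thms)
  have pfd: "y ^ fd S G = y ^ fd T F *
      (\<Prod>a\<in>?P. if a \<in> block \<and> even a \<and> a \<notin> D \<and> ?P - D \<noteq> {a} then y else 1)"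
    unfolding fd_def fG
    by (rule split[OF fins(2) sur(2)]) (simp_all only: outside inside Un_iff simp_thms)
  have PT: "a \<in> T" if "a \<in> ?P" for a using that fiber_sub by auto
  have "(\<Prod>a\<in>fiber F. if a \<in> D then if odd a then x else xb
        else if fiber F - D = {a} then if a \<in> truncation T then 1 else if odd a then z else yb
        else if a \<in> truncation T then 1 else if odd a then zb else y) =
    (\<Prod>a\<in>?P. (if a \<in> D \<and> odd a then x else 1) * (if a \<in> D \<and> even a then xb else 1) *
      (if a \<in> block \<and> odd a \<and> a \<notin> D \<and> ?P - D = {a} then z else 1) *
      (if a \<in> block \<and> odd a \<and> a \<notin> D \<and> ?P - D \<noteq> {a} then zb else 1) *
      (if a \<in> block \<and> even a \<and> a \<notin> D \<and> ?P - D = {a} then yb else 1) *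
      (if a \<in> block \<and> even a \<and> a \<notin> D \<and> ?P - D \<noteq> {a} then y else 1))"
  proof (rule prod.cong[OF refl], goal_cases)
    case (1 a)
    then have "a \<in> block \<longleftrightarrow> a \<notin> truncation T" using PT by simp
    then show ?case
      by (cases "a \<in> D"; cases "even a"; cases "a \<in> truncation T"; cases "?P - D = {a}")
        (simp_all del: Diff_iff)
  qed
  then show ?thesis
    unfolding pmo pme psi psd pfi pfd weight_def prod.distrib by (simp only: mult_ac)
qed

section \<open>The recurrence for a general set\<close>

lemma card_fiber:
  assumes F: "F \<in> staircases T"
  shows "card {a \<in> fiber F. odd a} = mo T F + card {a \<in> block. odd a}"
    and "card {a \<in> fiber F. even a} = me T F + 1"
proof -
  have sub: "truncation T \<subseteq> T" "finite (truncation T)"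
    using finT by (auto simp: truncation_def)
  have odd: "{a \<in> fiber F. odd a} = {a \<in> truncation T. odd a \<and> F a = mid} \<union> {a \<in> block. odd a}"
    using sub staircaseT_block[OF F] by (auto simp: fiber_def)
  show "card {a \<in> fiber F. odd a} = mo T F + card {a \<in> block. odd a}"
    unfolding odd mo_def using finT sub by (intro card_Un_disjoint) auto
  have even: "{a \<in> fiber F. even a} = {a \<in> truncation T. even a \<and> F a = mid} \<union> {mid}"
    using sub staircaseT_block[OF F] even_T2 mid by (auto simp: fiber_def)
  show "card {a \<in> fiber F. even a} = me T F + 1"
    unfolding even me_def using sub even_T2[OF mid(1,2)] by (subst card_Un_disjoint) auto
qed

lemma prod_fiber:
  fixes u v w t :: "'a :: comm_ring_1"
  assumes F: "F \<in> staircases T"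
  shows "(\<Prod>a\<in>fiber F. if a \<in> truncation T then if odd a then u else v else if odd a then w else t)
    = u ^ mo T F * v ^ me T F * w ^ card {a \<in> block. odd a} * t"
proof -
  let ?f = "\<lambda>a. if a \<in> truncation T then if odd a then u else v else if odd a then w else t"
  let ?A = "{a \<in> truncation T. F a = mid}"
  have sub: "truncation T \<subseteq> T" "finite (truncation T)"
    using finT by (auto simp: truncation_def)
  have fiber: "fiber F = ?A \<union> ({a \<in> block. odd a} \<union> {mid})"
    using sub staircaseT_block[OF F] even_T2 mid by (auto simp: fiber_def)
  have mid2: "mid \<notin> truncation T" using even_T2[OF mid(1,2)] by simp
  have "prod ?f (fiber F) = prod ?f ?A * prod ?f ({a \<in> block. odd a} \<union> {mid})"
    unfolding fiber using sub finT mid2 by (intro prod.union_disjoint) auto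
  also have "prod ?f ({a \<in> block. odd a} \<union> {mid}) = w ^ card {a \<in> block. odd a} * t"
    using finT mid2 mid(2) by (subst prod.union_disjoint) auto
  also have "prod ?f ?A = (\<Prod>a\<in>?A. (if odd a then u else 1) * (if even a then v else 1))"
    by (intro prod.cong) auto
  also have "\<dots> = u ^ mo T F * v ^ me T F"
    using sub by (simp add: prod.distrib mo_def me_def power_card_eq_prod[symmetric] conj_ac)
  finally show ?thesis by (simp add: mult_ac)
qed

lemma prod_parity:
  fixes x xb :: "'a :: comm_ring_1"
  assumes "finite A"
  shows "(\<Prod>a\<in>A. if odd a then x else xb) = x ^ card {a \<in> A. odd a} * xb ^ card {a \<in> A. even (a :: nat)}"
proof -
  have "(\<Prod>a\<in>A. if odd a then x else xb) = (\<Prod>a\<in>A. (if odd a then x else 1) * (if even a then xb else 1))"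
    by (intro prod.cong) auto
  then show ?thesis using assms by (simp only: prod.distrib power_card_eq_prod)
qed

text \<open>
  Here the correction terms are confined to the block, since for elements of the truncation of T it does
  not matter whether they are alone. The single even element of the block is mid; it contributes the
  term with yb - y, and each of the r odd elements contributes the same term with z - zb.
\<close>

lemma sum_lifts:
  fixes x y z xb yb zb :: "'a :: comm_ring_1"
  assumes F: "F \<in> staircases T"
  defines "r \<equiv> card {a \<in> block. odd a}"
  shows "(\<Sum>D | D \<subset> fiber F. \<Prod>a\<in>fiber F. if a \<in> D then if odd a then x else xb
        else if fiber F - D = {a} then if a \<in> truncation T then 1 else if odd a then z else yb
        else if a \<in> truncation T then 1 else if odd a then zb else y) =
    (x + 1) ^ mo T F * (xb + 1) ^ me T F * ((x + zb) ^ r * (y + xb)) +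
    x ^ mo T F * xb ^ me T F *
      (x ^ r * (yb - y - xb) + of_nat r * x ^ (r - 1) * xb * (z - zb))"
proof -
  let ?P = "fiber F"
  note cf = card_fiber[OF F, folded r_def]
  define f where "f a = (if odd a then x else xb)" for a :: nat
  define h where "h a = (if a \<in> truncation T then 1 else if odd a then z else yb)" for a
  define g where "g a = (if a \<in> truncation T then 1 else if odd a then zb else y)" for a
  let ?c = "\<lambda>a. (h a - g a) * prod f (?P - {a})"
  have sub: "block \<subseteq> ?P" using staircaseT_block[OF F] by auto
  have midP: "mid \<in> ?P" "mid \<in> block" using even_T2[OF mid(1,2)] mid(1) sub by auto
  have prod_f: "prod f (?P - {a}) = x ^ card {b \<in> ?P - {a}. odd b} * xb ^ card {b \<in> ?P - {a}. even b}" for a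
    unfolding f_def using fin_fiber by (intro prod_parity) auto
  have del: "{b \<in> ?P - {a}. Q b} = (if Q a then {b \<in> ?P. Q b} - {a} else {b \<in> ?P. Q b})" for a Q
    by auto
  \<comment> \<open>add, all and corr are the three summands of \<open>sum_proper_subsets_prod\<close>.\<close>
  have add: "(\<Prod>a\<in>?P. f a + g a) = (x + 1) ^ mo T F * (xb + 1) ^ me T F * (x + zb) ^ r * (xb + y)"
    unfolding r_def prod_fiber[OF F, symmetric] by (intro prod.cong) (auto simp: f_def g_def)
  have all: "prod f ?P = x ^ (mo T F + r) * xb ^ (me T F + 1)"
    unfolding f_def using cf by (simp only: prod_parity[OF fin_fiber])
  have c_mid: "?c mid = (yb - y) * (x ^ (mo T F + r) * xb ^ me T F)"
  proof -
    have "prod f (?P - {mid}) = x ^ (mo T F + r) * xb ^ me T F"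
      unfolding prod_f del using midP mid(2) cf by simp
    then show ?thesis using midP mid(2) by (simp add: h_def g_def)
  qed
  \<comment> \<open>The exponent r - 1 is a true difference because the block then has an odd element, a.\<close>
  have c_odd: "?c a = (z - zb) * (x ^ (mo T F + (r - 1)) * xb ^ (me T F + 1))"
    if a: "a \<in> {a \<in> block. odd a}" for a
  proof -
    have "0 < r" unfolding r_def using a finT by (subst card_gt_0_iff) auto
    moreover have "a \<in> ?P" using a sub by auto
    ultimately have "prod f (?P - {a}) = x ^ (mo T F + (r - 1)) * xb ^ (me T F + 1)"
      unfolding prod_f del using a cf by simp
    then show ?thesis using a by (simp add: h_def g_def)
  qed
  have "sum ?c ?P = sum ?c block"
    using sub fin_fiber fiber_sub by (intro sum.mono_neutral_right) (auto simp: h_def g_def)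
  also have "block = insert mid {a \<in> block. odd a}"
    using midP even_T2 by auto
  also have "sum ?c \<dots> = ?c mid + (\<Sum>a\<in>{a \<in> block. odd a}. ?c a)"
    using finT mid(2) by (intro sum.insert) auto
  also have "(\<Sum>a\<in>{a \<in> block. odd a}. ?c a) =
      of_nat r * ((z - zb) * (x ^ (mo T F + (r - 1)) * xb ^ (me T F + 1)))"
    unfolding r_def by (simp add: c_odd r_def)
  finally have corr: "sum ?c ?P = (yb - y) * (x ^ (mo T F + r) * xb ^ me T F) +
      of_nat r * ((z - zb) * (x ^ (mo T F + (r - 1)) * xb ^ (me T F + 1)))"
    unfolding c_mid .
  have "(\<Sum>D | D \<subset> ?P. \<Prod>a\<in>?P. if a \<in> D then f a else if ?P - D = {a} then h a else g a) =
    (x + 1) ^ mo T F * (xb + 1) ^ me T F * ((x + zb) ^ r * (y + xb)) +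
    x ^ mo T F * xb ^ me T F *
      (x ^ r * (yb - y - xb) + of_nat r * x ^ (r - 1) * xb * (z - zb))"
    unfolding sum_proper_subsets_prod[OF fin_fiber] add all corr
    by (simp add: algebra_simps power_add)
  then show ?thesis unfolding f_def g_def h_def .
qed

text \<open>
  Both terms of the lifted sum have the shape of a summand of Lambda on T, once with both maximum
  variables shifted by one and once without the shift.
\<close>

lemma Lambda_step:
  fixes x y z xb yb zb :: "'a :: comm_ring_1"
  defines "r \<equiv> card {a \<in> block. odd a}"
  shows "Lambda S x y z xb yb zb =
    (x + zb) ^ r * (y + xb) * Lambda T (x + 1) y z (xb + 1) yb zb +
    (x ^ r * (yb - y - xb) + of_nat r * x ^ (r - 1) * xb * (z - zb)) * Lambda T x y z xb yb zb"
proof -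
  have T: "Lambda T x' y z xb' yb zb =
      (\<Sum>F\<in>staircases T. weight y z yb zb F * (x' ^ mo T F * xb' ^ me T F))" for x' xb'
    unfolding Lambda_def weight_def by (intro sum.cong refl) (simp only: mult_ac)
  have "Lambda S x y z xb yb zb =
    (\<Sum>F\<in>staircases T. weight y z yb zb F *
      ((x + 1) ^ mo T F * (xb + 1) ^ me T F * ((x + zb) ^ r * (y + xb)) +
       x ^ mo T F * xb ^ me T F *
         (x ^ r * (yb - y - xb) + of_nat r * x ^ (r - 1) * xb * (z - zb))))"
    unfolding Lambda_def sum_staircases_step r_def
    by (intro sum.cong refl) (simp add: weight_lift sum_lifts flip: sum_distrib_left)
  then show ?thesis
    unfolding T by (simp add: sum_distrib_left sum.distrib distrib_left mult_ac)
qed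

end

section \<open>Equally spaced even elements\<close>

lemma mem_Snk:
  assumes "k \<ge> 1"
  shows "a \<in> Snk n k \<longleftrightarrow> odd a \<and> a < 2 * n * k \<or> (\<exists>i\<in>{1..n}. a = 2 * k * i)"
proof -
  have "a \<le> 2 * n * k - 1 \<longleftrightarrow> a < 2 * n * k" if "odd a"
    using that odd_pos[of a] by linarith
  then show ?thesis by (auto simp: Snk_def)
qed

lemma evens_Snk: "k \<ge> 1 \<Longrightarrow> evens (Snk n k) = (\<lambda>i. 2 * k * i) ` {1..n}"
  by (auto simp: evens_def mem_Snk)

lemma Snk_le: "k \<ge> 1 \<Longrightarrow> a \<in> Snk n k \<Longrightarrow> a \<le> 2 * k * n"
  by (auto simp: mem_Snk mult_ac)

lemma finite_Snk:
  assumes "k \<ge> 1"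
  shows "finite (Snk n k)"
  by (rule finite_subset[of _ "{..2 * k * n}"]) (auto intro: Snk_le[OF assms])

lemma top_in_Snk:
  assumes "k \<ge> 1"
  shows "2 * k * Suc n \<in> Snk (Suc n) k"
  unfolding mem_Snk[OF assms] by (intro disjI2 bexI[of _ "Suc n"]) auto

lemma Max_Snk:
  assumes "k \<ge> 1"
  shows "Max (Snk (Suc n) k) = 2 * k * Suc n"
  using assms by (intro Max_eqI finite_Snk Snk_le top_in_Snk)

text \<open>
  With n = 0 on the right this gives the empty set, so the number k of odd elements in
  a block needs no separate treatment of the first block.
\<close>

lemma truncation_Snk:
  assumes k: "k \<ge> 1"
  shows "truncation (Snk (Suc n) k) = Snk n k"
proof (rule set_eqI)
  fix a
  have ne: "Snk (Suc n) k \<noteq> {}" using top_in_Snk[OF k] by auto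
  have "a \<in> truncation (Snk (Suc n) k) \<longleftrightarrow>
      a \<in> Snk (Suc n) k \<and> (\<exists>i\<in>{1..n}. a \<le> 2 * k * i)"
  proof -
    have "2 * k * i < 2 * k * Suc n \<longleftrightarrow> i \<le> n" for i
      using k unfolding mult_less_cancel1 by auto
    moreover have "even (Max (Snk (Suc n) k))" using k by (simp add: Max_Snk)
    ultimately show ?thesis
      unfolding mem_truncation_iff[OF finite_Snk[OF k] ne, OF \<open>even _\<close>] evens_Snk[OF k] Max_Snk[OF k]
      by (auto simp del: mult_Suc_right)
  qed
  also have "(\<exists>i\<in>{1..n}. a \<le> 2 * k * i) \<longleftrightarrow> n \<noteq> 0 \<and> a \<le> 2 * k * n"
  proof
    assume "\<exists>i\<in>{1..n}. a \<le> 2 * k * i"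
    then obtain i where "1 \<le> i" "i \<le> n" "a \<le> 2 * k * i" by auto
    moreover have "2 * k * i \<le> 2 * k * n" using \<open>i \<le> n\<close> by simp
    ultimately show "n \<noteq> 0 \<and> a \<le> 2 * k * n" by linarith
  qed (auto intro!: bexI[of _ n])
  also have "a \<in> Snk (Suc n) k \<and> (n \<noteq> 0 \<and> a \<le> 2 * k * n) \<longleftrightarrow> a \<in> Snk n k"
  proof (cases "odd a")
    case True
    then have "a \<noteq> 2 * k * n" by auto
    then show ?thesis using True k by (cases "n = 0") (auto simp: mem_Snk mult_ac)
  next
    case False
    then show ?thesis using k by (auto simp: mem_Snk)
  qed
  finally show "a \<in> truncation (Snk (Suc n) k) \<longleftrightarrow> a \<in> Snk n k" .
qed

lemma card_odd_block_Snk: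
  assumes k: "k \<ge> 1"
  shows "card {a \<in> Snk (Suc n) k - Snk n k. odd a} = k"
proof -
  have iff: "odd a \<and> a \<in> Snk (Suc n) k - Snk n k \<longleftrightarrow>
      (\<exists>i<k. a = 2 * (n * k + i) + 1)" for a
  proof (cases "odd a")
    case True
    then obtain c where c: "a = 2 * c + 1" by (rule oddE)
    have half: "2 * c + 1 < 2 * t \<longleftrightarrow> c < t" for t :: nat by linarith
    have "a \<in> Snk m k \<longleftrightarrow> a < 2 * m * k" for m
      using k True by (auto simp: mem_Snk)
    then have mem: "a \<in> Snk m k \<longleftrightarrow> c < m * k" for m
      by (simp only: c mult.assoc half)
    have "a \<in> Snk (Suc n) k - Snk n k \<longleftrightarrow> n * k \<le> c \<and> c < n * k + k"
      unfolding Diff_iff mem mult_Suc by linarith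
    also have "\<dots> \<longleftrightarrow> (\<exists>i<k. c = n * k + i)"
    proof
      assume "n * k \<le> c \<and> c < n * k + k"
      then have "c - n * k < k" "c = n * k + (c - n * k)" by linarith+
      then show "\<exists>i<k. c = n * k + i" by (intro exI conjI)
    qed auto
    also have "\<dots> \<longleftrightarrow> (\<exists>i<k. a = 2 * (n * k + i) + 1)" by (simp only: c add_right_cancel mult_cancel1) simp
    finally show ?thesis using True by simp
  next
    case False
    then show ?thesis by auto
  qed
  have "{a \<in> Snk (Suc n) k - Snk n k. odd a} = (\<lambda>i. 2 * (n * k + i) + 1) ` {..<k}"
    using iff by blast
  then show ?thesis by (simp add: card_image inj_on_def)
qed

lemma Lambda_Snk_1:
  assumes k: "k \<ge> 1"
  shows "Lambda (Snk (Suc 0) k) x y z xb yb zb = 1"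
proof -
  let ?S = "Snk (Suc 0) k"
  have E: "evens ?S = {2 * k}" using k by (simp add: evens_Snk)
  have ne: "2 * k \<in> ?S" using k by (simp add: mem_Snk)
  have "staircases ?S = {restrict (\<lambda>_. 2 * k) ?S}"
    using ne Snk_le[OF k, of _ "Suc 0"] unfolding staircases_def E
    by (auto simp: PiE_singleton)
  moreover have "truncation ?S = {}" using k by (simp add: truncation_Snk mem_Snk set_eq_iff)
  ultimately show ?thesis
    by (simp add: Lambda_def mo_def me_def si_def sd_def fi_def fd_def surfixed_def fixedpts_def)
qed

lemma Lambda_Snk_Suc:
  fixes x y z xb yb zb :: "'a :: comm_ring_1"
  assumes k: "k \<ge> 1"
  shows "Lambda (Snk (Suc (Suc n)) k) x y z xb yb zb =
    (y + xb) * (x + zb) ^ k * Lambda (Snk (Suc n) k) (x + 1) y z (xb + 1) yb zb +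
    x ^ (k - 1) * (x * (yb - y) + of_nat k * xb * (z - zb) - x * xb) *
      Lambda (Snk (Suc n) k) x y z xb yb zb"
proof -
  have "inj_on (\<lambda>i. 2 * k * i) A" for A using k by (auto simp: inj_on_def)
  then have "card (evens (Snk (Suc (Suc n)) k)) = Suc (Suc n)"
    using k by (simp add: evens_Snk card_image)
  then interpret staircase_step "Snk (Suc (Suc n)) k"
    using k by unfold_locales (simp_all add: finite_Snk Max_Snk)
  have xk: "x ^ k = x ^ (k - 1) * x" using k by (cases k) (simp_all add: mult.commute)
  have "Lambda (Snk (Suc (Suc n)) k) x y z xb yb zb =
    (x + zb) ^ k * (y + xb) * Lambda (Snk (Suc n) k) (x + 1) y z (xb + 1) yb zb +
    (x ^ k * (yb - y - xb) + of_nat k * x ^ (k - 1) * xb * (z - zb)) *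
      Lambda (Snk (Suc n) k) x y z xb yb zb"
    using Lambda_step[of x y z xb yb zb]
    unfolding truncation_Snk[OF k] card_odd_block_Snk[OF k] .
  also have "x ^ k * (yb - y - xb) + of_nat k * x ^ (k - 1) * xb * (z - zb) =
    x ^ (k - 1) * (x * (yb - y) + of_nat k * xb * (z - zb) - x * xb)"
    unfolding xk by (simp add: algebra_simps)
  finally show ?thesis by (simp only: mult.commute[of "(x + zb) ^ k"])
qed

theorem theorem7p1:
  fixes k :: nat and x y z xb yb zb :: int_poly6
  defines "x \<equiv> var X" and "y \<equiv> var Y" and "z \<equiv> var Z"
    and "xb \<equiv> var Xbar" and "yb \<equiv> var Ybar" and "zb \<equiv> var Zbar"
  assumes "k \<ge> 1"
  shows "(\<lambda>m. let n = Suc m in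
            fps_const (pochhammer (y + xb) (n - 1) * (pochhammer (x + zb) (n - 1)) ^ k)
              * fps_X ^ (n - 1)
              * fps_recip (\<Prod>i = 0..n - 1. 1 - fps_const ((x + of_nat i) ^ (k - 1) *
                  ((x + of_nat i) * (yb - y) + of_nat k * (xb + of_nat i) * (z - zb)
                    - (x + of_nat i) * (xb + of_nat i))) * fps_X))
         sums Abs_fps (\<lambda>m. Lambda (Snk (Suc m) k) x y z xb yb zb)"
proof -
  \<comment> \<open>The recurrence shifts x and xb together, so one index i describes all values that occur.\<close>
  define L where "L m i = Lambda (Snk (Suc m) k) (x + of_nat i) y z (xb + of_nat i) yb zb" for m i
  define a where "a i = (x + of_nat i) ^ (k - 1) * ((x + of_nat i) * (yb - y) +
    of_nat k * (xb + of_nat i) * (z - zb) - (x + of_nat i) * (xb + of_nat i))" for i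
  define b where "b i = (y + xb + of_nat i) * (x + zb + of_nat i) ^ k" for i
  define G where "G i = Abs_fps (\<lambda>m. L m i)" for i
  have L0: "L 0 i = 1" for i
    using assms(7) by (simp add: L_def Lambda_Snk_1)
  have L_Suc: "L (Suc m) i = b i * L m (Suc i) + a i * L m i" for m i
    unfolding L_def Lambda_Snk_Suc[OF assms(7)] a_def b_def by (simp add: algebra_simps)
  have rec: "G i * (1 - fps_const (a i) * fps_X) = 1 + fps_const (b i) * fps_X * G (Suc i)" for i
  proof -
    have "G i = 1 + fps_const (b i) * (fps_X * G (Suc i)) + fps_const (a i) * (fps_X * G i)"
    proof (rule fps_ext)
      fix m
      show "fps_nth (G i) m = fps_nth (1 + fps_const (b i) * (fps_X * G (Suc i)) +
          fps_const (a i) * (fps_X * G i)) m"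
        by (cases m) (simp_all add: G_def L0 L_Suc)
    qed
    then show ?thesis by (simp add: right_diff_distrib diff_eq_eq mult_ac)
  qed
  have b: "(\<Prod>i<m. b i) = pochhammer (y + xb) m * pochhammer (x + zb) m ^ k" for m
    by (simp add: b_def prod.distrib pochhammer_prod prod_power_distrib lessThan_atLeast0)
  have "Abs_fps (\<lambda>m. Lambda (Snk (Suc m) k) x y z xb yb zb) = G 0"
    by (simp add: G_def L_def)
  with fps_sums_of_linear_recurrence[of G a b, OF rec] show ?thesis
    by (simp add: Let_def b a_def)
qed

end
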